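(* Let $(\mathcal{V},\mathcal{E},A)$ be a digraph and let $\mathcal{D},\mathcal{T}\subset\mathcal{V}$ be the sets of disturbance and target nodes, with $\mathcal{D}\cap\mathcal{T}=\emptyset$. The input node sets $\mathcal{B}$ computed by the DDPSF min-cut/max-flow algorithm are optimal solutions of Problem 2A, i.e. they minimize $|\mathcal{B}|$ over all $\mathcal{B}\subseteq\mathcal{V}\setminus\mathcal{D}$ subject to $\mathcal{D}\subseteq\mathcal{Z}^\circ(\mathcal{B})$.
   Context: $\mathcal{V}=\{v_1,\dots,v_n\}$; $(v_i,v_j)\in\mathcal{E}$ means $v_i\to v_j$; $A\in\mathbb{R}^{n\times n}$ has $A_{ji}\ne0$ if and only if $(v_i,v_j)\in\mathcal{E}$. For $\mathcal{B}\subseteq\mathcal{V}$, $\mathcal{Z}^\circ(\mathcal{B})$ is the (stationary) limit of $\mathcal{Z}_0=\mathcal{V}\setminus\mathcal{T}$, $\mathcal{Z}_{k+1}=\mathcal{Z}_k\setminus\{v_i\in\mathcal{Z}_k:\exists\,(v_i,v_j)\in\mathcal{E}\text{ with }v_j\notin\mathcal{Z}_k\cup\mathcal{B}\}$; it is the maximal subset $\mathcal{Z}$ of $\mathcal{V}\setminus\mathcal{T}$ such that every edge starting in $\mathcal{Z}$ ends in $\mathcal{Z}\cup\mathcal{B}$. It is a standing assumption of the problem that input nodes are not disturbance nodes ($\mathcal{D}\cap\mathcal{B}=\emptyset$). The algorithm. (1) Build the extended weighted network with nodes $\overline{\mathcal{V}}=\{v_1,\dots,v_{2n+2}\}$, source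 $v^{\mathcal{D}}=v_{2n+1}$, sink $v^{\mathcal{T}}=v_{2n+2}$, and the following edges: $(v_{i+n},v_j)$ of weight $+\infty$ for each $(v_i,v_j)\in\mathcal{E}$; $(v_i,v_{i+n})$ for each $i\in\{1,\dots,n\}$, of weight $1$ if $v_i\notin\mathcal{D}$ and $+\infty$ if $v_i\in\mathcal{D}$; $(v_{2n+1},v_d)$ of weight $+\infty$ for each $v_d\in\mathcal{D}$; $(v_{t+n},v_{2n+2})$ of weight $+\infty$ for each $v_t\in\mathcal{T}$. (2) By a min-cut/max-flow algorithm from $v^{\mathcal{D}}$ to $v^{\mathcal{T}}$, compute a minimum cut, i.e. a partition $\overline{\mathcal{V}}=\overline{\mathcal{J}}^{\mathcal{D}}\cup\overline{\mathcal{J}}^{\mathcal{T}}$ with $v^{\mathcal{D}}\in\overline{\mathcal{J}}^{\mathcal{D}}$, $v^{\mathcal{T}}\in\overline{\mathcal{J}}^{\mathcal{T}}$ minimizing the total weight of the edges from $\overline{\mathcal{J}}^{\mathcal{D}}$ to $\overline{\mathcal{J}}^{\mathcal{T}}$. (3) Output $\mathcal{B}$, the set of tails of the edges from $\overline{\mathcal{J}}^{\mathcal{D}}$ to $\overline{\mathcal{J}}^{\mathcal{T}}$. *)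

theory Defs
  imports Jordan_Normal_Form.Matrix "HOL-Library.Extended_Nonnegative_Real"
begin

text \<open>The nodes \<open>v\<^sub>1, \<dots>, v\<^sub>n\<close> are the numbers \<open>1, \<dots>, n\<close>. Matrices of
  type \<^typ>\<open>real mat\<close> are indexed from \<open>0\<close>, hence the shifts below.
  Note the transposition: the edge \<open>(i, j)\<close> corresponds to the entry in row \<open>j\<close> and column \<open>i\<close>.\<close>

definition weighted_digraph :: "nat \<Rightarrow> (nat \<times> nat) set \<Rightarrow> real mat \<Rightarrow> bool" where
  "weighted_digraph n E A \<longleftrightarrow>
     E \<subseteq> {1..n} \<times> {1..n} \<and> A \<in> carrier_mat n n \<and>
     (\<forall>i\<in>{1..n}. \<forall>j\<in>{1..n}. A $$ (j - 1, i - 1) \<noteq> 0 \<longleftrightarrow> (i, j) \<in> E)"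

primrec Z_seq :: "nat \<Rightarrow> (nat \<times> nat) set \<Rightarrow> nat set \<Rightarrow> nat set \<Rightarrow> nat \<Rightarrow> nat set" where
  "Z_seq n E T B 0 = {1..n} - T"
| "Z_seq n E T B (Suc k) = Z_seq n E T B k -
     {i \<in> Z_seq n E T B k. \<exists>j. (i, j) \<in> E \<and> j \<notin> Z_seq n E T B k \<union> B}"

text \<open>The value at which the sequence becomes stationary; it exists by
  \<open>Z_seq_eventually_Z_circ\<close> below.\<close>

definition Z_circ :: "nat \<Rightarrow> (nat \<times> nat) set \<Rightarrow> nat set \<Rightarrow> nat set \<Rightarrow> nat set" where
  "Z_circ n E T B = (THE Z. \<forall>\<^sub>F k in sequentially. Z_seq n E T B k = Z)"

definition ddpsf_feasible ::
  "nat \<Rightarrow> (nat \<times> nat) set \<Rightarrow> nat set \<Rightarrow> nat set \<Rightarrow> nat set \<Rightarrow> bool" where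
  "ddpsf_feasible n E D T B \<longleftrightarrow> B \<subseteq> {1..n} - D \<and> D \<subseteq> Z_circ n E T B"

definition ddpsf_optimal ::
  "nat \<Rightarrow> (nat \<times> nat) set \<Rightarrow> nat set \<Rightarrow> nat set \<Rightarrow> nat set \<Rightarrow> bool" where
  "ddpsf_optimal n E D T B \<longleftrightarrow> is_arg_min card (ddpsf_feasible n E D T) B"

definition is_cut :: "'a set \<Rightarrow> 'a \<Rightarrow> 'a \<Rightarrow> 'a set \<Rightarrow> 'a set \<Rightarrow> bool" where
  "is_cut N s t S S' \<longleftrightarrow> S \<union> S' = N \<and> S \<inter> S' = {} \<and> s \<in> S \<and> t \<in> S'"

definition cut_edges :: "('a \<times> 'a) set \<Rightarrow> 'a set \<Rightarrow> 'a set \<Rightarrow> ('a \<times> 'a) set" where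
  "cut_edges F S S' = {(u, v) \<in> F. u \<in> S \<and> v \<in> S'}"

definition cut_weight ::
  "('a \<times> 'a) set \<Rightarrow> ('a \<times> 'a \<Rightarrow> ennreal) \<Rightarrow> 'a set \<Rightarrow> 'a set \<Rightarrow> ennreal" where
  "cut_weight F w S S' = (\<Sum>e\<in>cut_edges F S S'. w e)"

definition is_min_cut ::
  "'a set \<Rightarrow> ('a \<times> 'a) set \<Rightarrow> ('a \<times> 'a \<Rightarrow> ennreal) \<Rightarrow> 'a \<Rightarrow> 'a \<Rightarrow> 'a set \<Rightarrow> 'a set \<Rightarrow> bool" where
  "is_min_cut N F w s t S S' \<longleftrightarrow> is_cut N s t S S' \<and>
     (\<forall>R R'. is_cut N s t R R' \<longrightarrow> cut_weight F w S S' \<le> cut_weight F w R R')"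

text \<open>In the extended network, node \<open>i + n\<close> is the second copy of node \<open>i\<close>; the source is
  \<open>2 * n + 1\<close> and the sink is \<open>2 * n + 2\<close>.\<close>

definition ext_nodes :: "nat \<Rightarrow> nat set" where
  "ext_nodes n = {1..2 * n + 2}"

definition ext_edges ::
  "nat \<Rightarrow> (nat \<times> nat) set \<Rightarrow> nat set \<Rightarrow> nat set \<Rightarrow> (nat \<times> nat) set" where
  "ext_edges n E D T =
     {(i + n, j) | i j. (i, j) \<in> E} \<union>
     {(i, i + n) | i. i \<in> {1..n}} \<union>
     {(2 * n + 1, d) | d. d \<in> D} \<union>
     {(t + n, 2 * n + 2) | t. t \<in> T}"

text \<open>For \<open>E \<subseteq> {1..n} \<times> {1..n}\<close> and \<open>D, T \<subseteq> {1..n}\<close> the four edge families are pairwise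
  disjoint, so only the edges \<open>(i, i + n)\<close> with \<open>i \<notin> D\<close> have finite weight.
  Values of the weight outside \<^const>\<open>ext_edges\<close> are irrelevant.\<close>

definition ext_weight :: "nat \<Rightarrow> nat set \<Rightarrow> nat \<times> nat \<Rightarrow> ennreal" where
  "ext_weight n D e = (if \<exists>i\<in>{1..n} - D. e = (i, i + n) then 1 else \<infinity>)"

text \<open>The algorithm is nondeterministic: every minimum cut yields a possible output.\<close>

definition ddpsf_output ::
  "nat \<Rightarrow> (nat \<times> nat) set \<Rightarrow> nat set \<Rightarrow> nat set \<Rightarrow> nat set \<Rightarrow> bool" where
  "ddpsf_output n E D T B \<longleftrightarrow>
     (\<exists>J\<^sub>D J\<^sub>T.
        is_min_cut (ext_nodes n) (ext_edges n E D T) (ext_weight n D) (2 * n + 1) (2 * n + 2) J\<^sub>D J\<^sub>T \<and>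
        B = fst ` cut_edges (ext_edges n E D T) J\<^sub>D J\<^sub>T)"

lemma Z_seq_eventually_const: "\<exists>Z. \<forall>\<^sub>F k in sequentially. Z_seq n E T B k = Z"
proof -
  let ?Z = "Z_seq n E T B"
  have fin: "finite (?Z k)" for k
    by (induction k) auto
  obtain k0 where k0: "\<And>k. card (?Z k0) \<le> card (?Z k)"
    using ex_has_least_nat[of "\<lambda>_. True" 0 "\<lambda>k. card (?Z k)"] by auto
  have "?Z (Suc k0) = ?Z k0"
    by (rule card_subset_eq[OF fin]) (use k0[of "Suc k0"] fin in \<open>auto intro!: antisym card_mono\<close>)
  then have "?Z (k0 + m) = ?Z k0" for m
    by (induction m) auto
  then have "\<forall>k\<ge>k0. ?Z k = ?Z k0"
    using le_Suc_ex by blast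
  then show ?thesis
    unfolding eventually_sequentially by blast
qed

lemma Z_seq_eventually_Z_circ: "\<forall>\<^sub>F k in sequentially. Z_seq n E T B k = Z_circ n E T B"
proof -
  have "\<exists>!Z. \<forall>\<^sub>F k in sequentially. Z_seq n E T B k = Z"
  proof (rule ex_ex1I[OF Z_seq_eventually_const])
    fix Y Z
    assume "\<forall>\<^sub>F k in sequentially. Z_seq n E T B k = Y" "\<forall>\<^sub>F k in sequentially. Z_seq n E T B k = Z"
    then have "\<forall>\<^sub>F k in sequentially. Y = Z"
      by eventually_elim simp
    then show "Y = Z" by simp
  qed
  then show ?thesis
    unfolding Z_circ_def by (rule theI')
qed

lemma Z_circ_invariant:
  shows "Z_circ n E T B \<subseteq> {1..n} - T"
    and "\<lbrakk>i \<in> Z_circ n E T B; (i, j) \<in> E\<rbrakk> \<Longrightarrow> j \<in> Z_circ n E T B \<union> B"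
proof -
  obtain k where k: "\<And>m. m \<ge> k \<Longrightarrow> Z_seq n E T B m = Z_circ n E T B"
    using Z_seq_eventually_Z_circ[of n E T B] unfolding eventually_sequentially by blast
  have sub: "Z_seq n E T B m \<subseteq> {1..n} - T" for m
    by (induction m) auto
  show "Z_circ n E T B \<subseteq> {1..n} - T"
    using sub[of k] k[of k] by simp
  show "j \<in> Z_circ n E T B \<union> B" if "i \<in> Z_circ n E T B" "(i, j) \<in> E"
    using that k[of k] k[of "Suc k"] by auto
qed

lemma Z_circ_greatest:
  assumes "Z \<subseteq> {1..n} - T" and "\<And>i j. \<lbrakk>i \<in> Z; (i, j) \<in> E\<rbrakk> \<Longrightarrow> j \<in> Z \<union> B"
  shows "Z \<subseteq> Z_circ n E T B"
proof -
  have "Z \<subseteq> Z_seq n E T B k" for k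
  proof (induction k)
    case 0
    show ?case using assms(1) by simp
  next
    case (Suc k)
    show ?case
    proof
      fix i assume i: "i \<in> Z"
      have "j \<in> Z_seq n E T B k \<union> B" if "(i, j) \<in> E" for j
        using assms(2)[OF i that] Suc by blast
      then show "i \<in> Z_seq n E T B (Suc k)"
        using i Suc by auto
    qed
  qed
  moreover obtain k where "Z_seq n E T B k = Z_circ n E T B"
    using Z_seq_eventually_Z_circ[of n E T B] unfolding eventually_sequentially by blast
  ultimately show ?thesis by metis
qed

lemma ddpsf_output_exists: "\<exists>B. ddpsf_output n E D T B"
proof -
  let ?c = "\<lambda>(S, S'). is_cut (ext_nodes n) (2 * n + 1) (2 * n + 2) S S'"
  let ?w = "\<lambda>(S, S'). cut_weight (ext_edges n E D T) (ext_weight n D) S S'"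
  have "Collect ?c \<subseteq> Pow (ext_nodes n) \<times> Pow (ext_nodes n)"
    by (auto simp: is_cut_def)
  then have fin: "finite (Collect ?c)"
    by (rule finite_subset) (simp add: ext_nodes_def)
  have "({1..2 * n + 1}, {2 * n + 2}) \<in> Collect ?c"
    by (auto simp: is_cut_def ext_nodes_def)
  then obtain p where p: "p \<in> Collect ?c" "\<And>q. q \<in> Collect ?c \<Longrightarrow> ?w p \<le> ?w q"
    using ex_is_arg_min_if_finite[OF fin, of ?w] by (auto simp: is_arg_min_linorder)
  then show ?thesis
    unfolding ddpsf_output_def is_min_cut_def by (cases p) fastforce
qed

end

theory Submission imports Defs begin

text \<open>Splitting each node \<open>i\<close> into an arc \<open>(i, i + n)\<close> turns the choice of a set of nodes into the
  choice of a set of arcs, and the infinite weights rule out cutting anything but the arcs of nodes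
  outside \<open>D\<close>. The theorem then follows from a correspondence between the feasible input sets and
  the cuts of finite weight.

  A cut of finite weight has as many edges as tails, so its weight is the number of its tails
  (\<open>cut_weight_eq_card_tails\<close>). The tails form a feasible input set: the nodes whose second copy is
  on the source side form a set that contains \<open>D\<close>, avoids \<open>T\<close> and can be left only through a tail,
  because leaving it in any other way would cut an edge of infinite weight
  (\<open>finite_cut_tails_feasible\<close>). Conversely, a feasible \<open>B\<close> yields a cut whose source side contains
  the first copies of \<open>Z \<union> B\<close> and the second copies of \<open>Z\<close>, where \<open>Z\<close> is \<^term>\<open>Z_circ n E T B\<close>; it
  cuts only arcs of nodes in \<open>B\<close> and so weighs at most \<^term>\<open>card B\<close>
  (\<open>feasible_cut_weight_le_card\<close>).

  Since \<open>D\<close> and \<open>T\<close> are disjoint, the complement of \<open>D\<close> is feasible. So some cut is finite, hence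
  every minimum cut is; its tails are then feasible, and no feasible set is smaller because a smaller
  one would give a lighter cut.\<close>

section \<open>Cuts of finite weight\<close>

lemma finite_ext_edges:
  assumes "E \<subseteq> {1..n} \<times> {1..n}" "D \<subseteq> {1..n}" "T \<subseteq> {1..n}"
  shows "finite (ext_edges n E D T)"
proof (rule finite_subset)
  show "ext_edges n E D T \<subseteq> {0..2*n+1} \<times> {0..2*n+2}"
    using assms unfolding ext_edges_def by fastforce
qed simp

lemma finite_cut_weight_imp_finite_weight:
  assumes "finite F" "cut_weight F w S S' \<noteq> \<infinity>" "e \<in> cut_edges F S S'"
  shows "w e \<noteq> \<infinity>"
proof -
  have "finite (cut_edges F S S')"
    using assms(1) by (rule finite_subset[rotated]) (auto simp: cut_edges_def)
  then show ?thesis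
    using assms(2,3) by (auto simp: cut_weight_def)
qed

lemma ext_weight_finite_iff: "ext_weight n D e \<noteq> \<infinity> \<longleftrightarrow> (\<exists>i\<in>{1..n} - D. e = (i, i + n))"
  by (simp add: ext_weight_def)

text \<open>An arc \<open>(i, i + n)\<close> is determined by its tail, so no two cut edges share a tail.\<close>

lemma cut_weight_eq_card_tails:
  assumes "\<And>e. e \<in> cut_edges F S S' \<Longrightarrow> \<exists>i\<in>{1..n} - D. e = (i, i + n)"
  shows "cut_weight F (ext_weight n D) S S' = of_nat (card (fst ` cut_edges F S S'))"
proof -
  have "cut_weight F (ext_weight n D) S S' = (\<Sum>e\<in>cut_edges F S S'. 1)"
    unfolding cut_weight_def by (rule sum.cong) (auto simp: ext_weight_def dest!: assms)
  moreover have "inj_on fst (cut_edges F S S')"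
    by (rule inj_onI) (auto dest!: assms)
  ultimately show ?thesis
    by (simp add: card_image)
qed

section \<open>From finite cuts to feasible input sets\<close>

text \<open>The invariant set is that of the nodes whose second copy lies on the source side. An edge
  leaving it reaches a node with only its first copy on the source side, and the arc between the
  two copies of that node is then cut.\<close>

lemma finite_cut_tails_feasible:
  assumes E: "E \<subseteq> {1..n} \<times> {1..n}" and D: "D \<subseteq> {1..n}" and T: "T \<subseteq> {1..n}"
    and cut: "is_cut (ext_nodes n) (2 * n + 1) (2 * n + 2) S S'"
    and unit_arcs: "\<And>e. e \<in> cut_edges (ext_edges n E D T) S S' \<Longrightarrow> \<exists>i\<in>{1..n} - D. e = (i, i + n)"
  shows "ddpsf_feasible n E D T (fst ` cut_edges (ext_edges n E D T) S S')" (is "ddpsf_feasible n E D T ?B")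
proof -
  have stays: "v \<in> S"
    if "(u, v) \<in> ext_edges n E D T" "u \<in> S" "v \<in> ext_nodes n" "\<And>i. i \<in> {1..n} - D \<Longrightarrow> (u, v) \<noteq> (i, i + n)"
    for u v
    using that cut unit_arcs[of "(u, v)"] by (auto simp: is_cut_def cut_edges_def)
  have source: "2 * n + 1 \<in> S" and sink: "2 * n + 2 \<notin> S"
    using cut by (auto simp: is_cut_def)
  define Z where "Z = {i \<in> {1..n}. i + n \<in> S}"
  have "D \<subseteq> Z"
  proof
    fix d assume d: "d \<in> D"
    then have dn: "d \<in> {1..n}" using D by blast
    have "d \<in> S"
      by (rule stays[OF _ source]) (use d dn in \<open>auto simp: ext_edges_def ext_nodes_def\<close>)
    then have "d + n \<in> S"
      by (rule stays[rotated]) (use d dn in \<open>auto simp: ext_edges_def ext_nodes_def\<close>)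
    then show "d \<in> Z" using dn by (simp add: Z_def)
  qed
  moreover have "Z \<subseteq> Z_circ n E T ?B"
  proof (rule Z_circ_greatest)
    have False if "t \<in> T" "t + n \<in> S" for t
      using stays[OF _ that(2), of "2 * n + 2"] sink that(1) T
      by (auto simp: ext_edges_def ext_nodes_def)
    then show "Z \<subseteq> {1..n} - T"
      by (auto simp: Z_def)
  next
    fix i j assume i: "i \<in> Z" and ij: "(i, j) \<in> E"
    then have j: "j \<in> {1..n}" and "i + n \<in> S" using E by (auto simp: Z_def)
    then have jS: "j \<in> S"
      using ij by (intro stays[of "i + n" j]) (auto simp: ext_edges_def ext_nodes_def)
    show "j \<in> Z \<union> ?B"
    proof (cases "j + n \<in> S")
      case True
      then show ?thesis using j by (simp add: Z_def)
    next
      case False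
      then have "j + n \<in> S'"
        using cut j by (auto simp: is_cut_def ext_nodes_def)
      then have "(j, j + n) \<in> cut_edges (ext_edges n E D T) S S'"
        using j jS by (auto simp: cut_edges_def ext_edges_def)
      then show ?thesis by force
    qed
  qed
  moreover have "?B \<subseteq> {1..n} - D"
    using unit_arcs by fastforce
  ultimately show ?thesis
    by (auto simp: ddpsf_feasible_def)
qed

section \<open>From feasible input sets to finite cuts\<close>

text \<open>The first copies of \<open>B\<close> are put on the source side and only second copies of \<open>Z\<close> join
  them, so that an edge leaving \<open>Z\<close> is not cut but every input node outside \<open>Z\<close> is cut at
  its arc. Input nodes inside \<open>Z\<close> cost nothing, so in general only an inequality holds.\<close>

lemma feasible_cut_weight_le_card:
  assumes E: "E \<subseteq> {1..n} \<times> {1..n}" and D: "D \<subseteq> {1..n}" and T: "T \<subseteq> {1..n}"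
    and feas: "ddpsf_feasible n E D T B"
  obtains S S' where "is_cut (ext_nodes n) (2 * n + 1) (2 * n + 2) S S'"
    and "cut_weight (ext_edges n E D T) (ext_weight n D) S S' \<le> of_nat (card B)"
proof
  define Z where "Z = Z_circ n E T B"
  define S where "S = insert (2 * n + 1) (Z \<union> B \<union> (\<lambda>i. i + n) ` Z)"
  let ?C = "cut_edges (ext_edges n E D T) S (ext_nodes n - S)"
  have B: "B \<subseteq> {1..n} - D" and DZ: "D \<subseteq> Z"
    using feas by (auto simp: ddpsf_feasible_def Z_def)
  have Z: "Z \<subseteq> {1..n} - T"
    unfolding Z_def by (rule Z_circ_invariant(1))
  have Z_step: "j \<in> Z \<union> B" if "i \<in> Z" "(i, j) \<in> E" for i j
    using Z_circ_invariant(2) that unfolding Z_def by blast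
  show "is_cut (ext_nodes n) (2 * n + 1) (2 * n + 2) S (ext_nodes n - S)"
    using Z B by (fastforce simp: is_cut_def S_def ext_nodes_def)
  have first_copy: "i \<in> S \<longleftrightarrow> i \<in> Z \<union> B" and second_copy: "i + n \<in> S \<longleftrightarrow> i \<in> Z" if "i \<in> {1..n}" for i
    using that Z B by (auto simp: S_def)
  have arcs: "\<exists>i\<in>B. e = (i, i + n)" if "e \<in> ?C" for e
  proof -
    from that have "e \<in> ext_edges n E D T" and tail: "fst e \<in> S" and head: "snd e \<notin> S"
      by (auto simp: cut_edges_def)
    then consider (edge) i j where "(i, j) \<in> E" "e = (i + n, j)"
      | (arc) i where "i \<in> {1..n}" "e = (i, i + n)"
      | (disturbance) d where "d \<in> D" "e = (2 * n + 1, d)"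
      | (target) t where "t \<in> T" "e = (t + n, 2 * n + 2)"
      by (auto simp: ext_edges_def)
    then show ?thesis
    proof cases
      case edge
      then have "i \<in> {1..n}" "j \<in> {1..n}" using E by auto
      then show ?thesis using edge tail head Z_step[of i j] first_copy second_copy by auto
    next
      case arc
      then show ?thesis using tail head first_copy second_copy by auto
    next
      case disturbance
      then show ?thesis using head DZ by (auto simp: S_def)
    next
      case target
      then have "t \<in> {1..n}" using T by blast
      then show ?thesis using target tail second_copy Z by auto
    qed
  qed
  have "finite B" using B by (rule finite_subset) simp
  moreover have "fst ` ?C \<subseteq> B"
    using arcs by fastforce
  ultimately have "card (fst ` ?C) \<le> card B"
    by (rule card_mono)
  moreover have "\<exists>i\<in>{1..n} - D. e = (i, i + n)" if "e \<in> ?C" for e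
    using arcs[OF that] B by blast
  then have "cut_weight (ext_edges n E D T) (ext_weight n D) S (ext_nodes n - S) = of_nat (card (fst ` ?C))"
    by (rule cut_weight_eq_card_tails)
  ultimately show
    "cut_weight (ext_edges n E D T) (ext_weight n D) S (ext_nodes n - S) \<le> of_nat (card B)"
    by simp
qed

section \<open>Optimality of the outputs\<close>

text \<open>Every edge out of \<open>D\<close> ends in \<open>D\<close> or in its complement, so \<open>D\<close> itself is invariant.\<close>

lemma complement_feasible:
  assumes "E \<subseteq> {1..n} \<times> {1..n}" "D \<subseteq> {1..n}" "D \<inter> T = {}"
  shows "ddpsf_feasible n E D T ({1..n} - D)"
  unfolding ddpsf_feasible_def using assms by (auto intro!: Z_circ_greatest[THEN subsetD, of D])

theorem theorem5:
  fixes n :: nat and E :: "(nat \<times> nat) set" and A :: "real mat" and D T B :: "nat set"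
  assumes "weighted_digraph n E A"
    and "D \<subseteq> {1..n}" and "T \<subseteq> {1..n}" and "D \<inter> T = {}"
    and "ddpsf_output n E D T B"
  shows "ddpsf_optimal n E D T B"
proof -
  have E: "E \<subseteq> {1..n} \<times> {1..n}"
    using assms(1) by (simp add: weighted_digraph_def)
  let ?F = "ext_edges n E D T"
  let ?w = "cut_weight ?F (ext_weight n D)"
  obtain S S' where cut: "is_cut (ext_nodes n) (2 * n + 1) (2 * n + 2) S S'"
    and min: "\<And>R R'. is_cut (ext_nodes n) (2 * n + 1) (2 * n + 2) R R' \<Longrightarrow> ?w S S' \<le> ?w R R'"
    and B: "B = fst ` cut_edges ?F S S'"
    using assms(5) unfolding ddpsf_output_def is_min_cut_def by blast
  have le: "?w S S' \<le> of_nat (card C)" if C: "ddpsf_feasible n E D T C" for C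
  proof -
    obtain R R' where "is_cut (ext_nodes n) (2 * n + 1) (2 * n + 2) R R'" "?w R R' \<le> of_nat (card C)"
      by (rule feasible_cut_weight_le_card[OF E assms(2,3) C])
    then show ?thesis using min order_trans by blast
  qed
  have "?w S S' \<le> of_nat (card ({1..n} - D))"
    by (rule le) (rule complement_feasible[OF E assms(2,4)])
  also have "\<dots> < \<infinity>"
    by (simp add: of_nat_less_top)
  finally have finite_weight: "?w S S' \<noteq> \<infinity>"
    by simp
  have unit_arcs: "\<exists>i\<in>{1..n} - D. e = (i, i + n)" if "e \<in> cut_edges ?F S S'" for e
    using finite_cut_weight_imp_finite_weight[OF finite_ext_edges[OF E assms(2,3)] finite_weight that]
    by (simp only: ext_weight_finite_iff)
  have "ddpsf_feasible n E D T B"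
    unfolding B using E assms(2,3) cut unit_arcs by (rule finite_cut_tails_feasible)
  moreover have "card B \<le> card C" if "ddpsf_feasible n E D T C" for C
    using le[OF that] cut_weight_eq_card_tails[of ?F S S', OF unit_arcs] by (simp add: B)
  ultimately show ?thesis
    by (simp add: ddpsf_optimal_def is_arg_min_linorder)
qed

end
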